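(* Let $G$ be a graph as in the context, let $C$ be either blue or red, let $v,u\in\mathcal P_C(G)$, and let $w_v,w_u\in\bar C_v$ be such that $e_v=(v,w_v)$ and $e_u=(u,w_u)$ are not existing edges of $G$. Let $\Sigma=\{e_v,e_u\}$. Then $$\Delta(G,\mathcal P_C(G),e_v,m_{e_v},t)\le\Delta(G,\mathcal P_C(G),\Sigma,\{m_e\}_{e\in\Sigma},t)$$ and $$\Delta(G,\mathcal P_C(G),\Sigma,\{m_e\}_{e\in\Sigma},t)\le\Delta(G,\mathcal P_C(G),e_v,m_{e_v},t)+\Delta(G,\mathcal P_C(G),e_u,m_{e_u},t).$$
   Context: $G=(V,E)$ is a finite directed graph, each vertex is colored red or blue, with a right-stochastic transition matrix $M=(m_{ij})$, $m_{ij}=0$ if $(i,j)\notin E$; $m_{ij}$ is the weight of edge $(i,j)$. There are no self-loops. Random walks move according to $M$. $\bar C_v$ is the set of vertices of color different from that of $v$. For a positive integer $s$, the bubble radius is $\mathsf B^{s}_G(v)=\mathbb E_G[\min\{s,T_v(\bar C_v)\}]$, where $T_v(S)$ is the first time a random walk from $v$ hits $S$. A positive integer $t$ is fixed; the paper's thresholds are $b=2$, $r=t/2$ with $1\le b<r\le t$. $\mathcal P_C(G)$ is the set of vertices $v$ of color $C$ with $\mathsf B^t_G(v)\ge t/2$ (parochial vertices of color $C$). Edge insertion: inserting a new edge $e=(v,w)$ with weight $m_e\in[0,1]$ means giving $(v,w)$ weight $m_e$ and multiplying the weights of all other edges leaving $v$ by $1-m_e$. The weights $m_{e_v},m_{e_u}$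 of the inserted edges are given. Gain: for a nonempty $U\subseteq V$ and a set $\Sigma$ of new edges (a single edge $e$ is identified with $\{e\}$) with weights $\{m_e\}$, $\Delta(G,U,\Sigma,\{m_e\}_{e\in\Sigma},s)=\frac1{|U|}\sum_{u\in U}\bigl(\mathsf B^{s}_G(u)-\mathsf B^{s}_{G_{\rm new}}(u)\bigr)$, where $G_{\rm new}$ is $G$ after inserting $\Sigma$ with these weights. *)

theory Defs
  imports "HOL-Probability.Probability" "Graph_Theory.Pair_Digraph"
begin

datatype color = Red | Blue

record 'a walk_graph = "'a pair_pre_digraph" +
  color :: "'a \<Rightarrow> color"
  weight :: "'a \<Rightarrow> 'a \<Rightarrow> real"

text \<open>
  The locale \<open>pair_digraph\<close> (finite, no self-loops) is stated for the unextended record type,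
  hence the truncation. Weights are only constrained on the vertex set.
\<close>

locale walk_graph = pair_digraph "pair_pre_digraph.truncate G"
  for G :: "'a walk_graph" +
  assumes weight_nonneg: "\<lbrakk>i \<in> pverts G; j \<in> pverts G\<rbrakk> \<Longrightarrow> 0 \<le> weight G i j"
    and weight_row_sum: "i \<in> pverts G \<Longrightarrow> (\<Sum>j\<in>pverts G. weight G i j) = 1"
    and weight_non_edge:
      "\<lbrakk>i \<in> pverts G; j \<in> pverts G; (i, j) \<notin> parcs G\<rbrakk> \<Longrightarrow> weight G i j = 0"

definition other_color :: "'a walk_graph \<Rightarrow> 'a \<Rightarrow> 'a set" where
  "other_color G v = {x \<in> pverts G. color G x \<noteq> color G v}"

text \<open>
  The law of the random walk from \<open>v\<close> is the measure on trajectories \<open>nat \<Rightarrow> 'a\<close> given by the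
  Ionescu-Tulcea theorem: \<open>walk_kernel G v n \<omega>\<close> is the distribution of the position at time \<open>n\<close>
  conditional on the positions \<open>\<omega> 0, \<dots>, \<omega> (n - 1)\<close>.
\<close>

definition walk_kernel :: "'a walk_graph \<Rightarrow> 'a \<Rightarrow> nat \<Rightarrow> (nat \<Rightarrow> 'a) \<Rightarrow> 'a measure" where
  "walk_kernel G v n \<omega> =
     (case n of
        0 \<Rightarrow> return (count_space (pverts G)) v
      | Suc k \<Rightarrow> point_measure (pverts G) (\<lambda>j. ennreal (weight G (\<omega> k) j)))"

definition random_walk :: "'a walk_graph \<Rightarrow> 'a \<Rightarrow> (nat \<Rightarrow> 'a) measure" where
  "random_walk G v =
     projective_family.lim UNIV
       (Ionescu_Tulcea.CI (walk_kernel G v) (\<lambda>_. count_space (pverts G)))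
       (\<lambda>_. count_space (pverts G))"

definition hitting_time :: "'a set \<Rightarrow> (nat \<Rightarrow> 'a) \<Rightarrow> enat" where
  "hitting_time S \<omega> = Inf {enat n |n. \<omega> n \<in> S}"

definition bubble_radius :: "'a walk_graph \<Rightarrow> nat \<Rightarrow> 'a \<Rightarrow> real" where
  "bubble_radius G s v =
     (\<integral>\<omega>. real (the_enat (min (enat s) (hitting_time (other_color G v) \<omega>))) \<partial>random_walk G v)"

definition parochial :: "'a walk_graph \<Rightarrow> color \<Rightarrow> nat \<Rightarrow> 'a set" where
  "parochial G C t = {v \<in> pverts G. color G v = C \<and> real t / 2 \<le> bubble_radius G t v}"

definition insert_edge :: "('a \<times> 'a \<Rightarrow> real) \<Rightarrow> 'a \<times> 'a \<Rightarrow> 'a walk_graph \<Rightarrow> 'a walk_graph" where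
  "insert_edge m e G =
     G\<lparr>parcs := insert e (parcs G),
       weight := (\<lambda>i j. if (i, j) = e then m e
                        else if i = fst e then (1 - m e) * weight G i j
                        else weight G i j)\<rparr>"

text \<open>
  A set of new edges is given by an enumeration. The edges are inserted one after the other;
  the order matters for the resulting weights only among edges leaving the same vertex.
\<close>

definition insert_edges :: "('a \<times> 'a \<Rightarrow> real) \<Rightarrow> ('a \<times> 'a) list \<Rightarrow> 'a walk_graph \<Rightarrow> 'a walk_graph" where
  "insert_edges m es G = fold (insert_edge m) es G"

definition gain ::
    "'a walk_graph \<Rightarrow> 'a set \<Rightarrow> ('a \<times> 'a) list \<Rightarrow> ('a \<times> 'a \<Rightarrow> real) \<Rightarrow> nat \<Rightarrow> real" where
  "gain G U es m s =
     (1 / real (card U)) *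
     (\<Sum>u\<in>U. bubble_radius G s u - bubble_radius (insert_edges m es G) s u)"

text \<open>The walk measure is obtained from an actual instance of the Ionescu-Tulcea theorem.\<close>

lemma (in walk_graph) Ionescu_Tulcea_walk_kernel:
  assumes v: "v \<in> pverts G"
  shows "Ionescu_Tulcea (walk_kernel G v) (\<lambda>_. count_space (pverts G))"
proof -
  have fin: "finite (pverts G)"
    using pair_finite_verts by (simp add: pair_pre_digraph.truncate_def)
  have step: "prob_space (point_measure (pverts G) (\<lambda>j. ennreal (weight G i j)))"
    if "i \<in> pverts G" for i
    using that fin
    by (intro prob_spaceI)
      (simp add: space_point_measure emeasure_point_measure_finite weight_nonneg
        sum_ennreal weight_row_sum)
  have coord: "(\<lambda>\<omega>. \<omega> k) \<in> measurable (PiM {0..<Suc k} (\<lambda>_. count_space (pverts G)))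
      (count_space (pverts G))" for k
    by (rule measurable_component_singleton) simp
  have kernel: "(\<lambda>i. point_measure (pverts G) (\<lambda>j. ennreal (weight G i j)))
      \<in> measurable (count_space (pverts G)) (subprob_algebra (count_space (pverts G)))"
    using step
    by (auto simp: space_subprob_algebra sets_point_measure intro: prob_space_imp_subprob_space)
  have 1: "walk_kernel G v n \<in> measurable (PiM {0..<n} (\<lambda>_. count_space (pverts G)))
      (subprob_algebra (count_space (pverts G)))" for n
  proof (cases n)
    case 0
    have "return (count_space (pverts G)) v
        \<in> space (subprob_algebra (count_space (pverts G)))"
      using v by (auto simp: space_subprob_algebra
          intro!: prob_space_imp_subprob_space prob_space_return)
    then show ?thesis
      by (simp add: 0 walk_kernel_def[abs_def])
  next
    case (Suc k)
    show ?thesis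
      using measurable_compose[OF coord[of k] kernel]
      by (simp add: Suc walk_kernel_def[abs_def])
  qed
  have 2: "prob_space (walk_kernel G v n \<omega>)"
    if "\<omega> \<in> space (PiM {0..<n} (\<lambda>_. count_space (pverts G)))" for n \<omega>
  proof (cases n)
    case 0
    then show ?thesis
      using v by (simp add: walk_kernel_def prob_space_return)
  next
    case (Suc k)
    then show ?thesis
      using that by (auto simp: walk_kernel_def space_PiM PiE_iff intro!: step)
  qed
  show ?thesis
    using 1 2 by (rule Ionescu_Tulcea.intro)
qed

end

theory Submission
  imports Defs
begin

text \<open>
  Let \<open>A\<close> be the set of vertices of color \<open>C\<close>. Started in \<open>A\<close>, the bubble radius is the sum over
  \<open>k < t\<close> of the probabilities \<open>(Q ^ k 1) v\<close> of staying in \<open>A\<close> up to time \<open>k\<close>, where \<open>Q\<close> is the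
  weight matrix restricted to \<open>A\<close>. A new edge leaves \<open>A\<close>, so inserting it only multiplies one row
  of \<open>Q\<close> by a factor in \<open>[0, 1]\<close>. With row factors \<open>a\<close>, \<open>b\<close> for the two single insertions and \<open>c\<close>
  for their joint insertion, the survival probabilities are antitone and supermodular,
  \<open>p\<^sub>a + p\<^sub>b \<le> p + p\<^sub>c\<close>, by induction on \<open>k\<close>.
\<close>

section \<open>Survival under a killed operator and its supermodularity in the row factors\<close>

definition killed :: "('a \<Rightarrow> 'a \<Rightarrow> real) \<Rightarrow> 'a set \<Rightarrow> ('a \<Rightarrow> real) \<Rightarrow> 'a \<Rightarrow> real" where
  "killed w A f i = (\<Sum>j\<in>A. w i j * f j)"

lemma killed_funpow_nonneg:
  assumes "\<And>i j. i \<in> A \<Longrightarrow> j \<in> A \<Longrightarrow> 0 \<le> w i j" and "\<And>i. i \<in> A \<Longrightarrow> 0 \<le> f i" and "i \<in> A"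
  shows "0 \<le> (killed w A ^^ k) f i"
  using assms(3)
proof (induction k arbitrary: i)
  case (Suc k)
  then show ?case
    by (auto simp: killed_def intro!: sum_nonneg mult_nonneg_nonneg assms(1))
qed (simp add: assms(2))

text \<open>View \<open>1, a, b, c\<close> and \<open>P, Pa, Pb, Pc\<close> as functions on the
  subsets of a two-element set. Both are nonnegative, antitone and supermodular, and such functions
  are closed under products.\<close>

lemma supermodular_scaling:
  fixes P Pa Pb Pc a b c :: real
  assumes "0 \<le> Pc" "Pc \<le> Pa" "Pc \<le> Pb" "Pa \<le> P" "Pb \<le> P" "Pa + Pb \<le> P + Pc"
    and "0 \<le> c" "c \<le> a" "c \<le> b" "a \<le> 1" "b \<le> 1" "a + b \<le> 1 + c"
  shows "a * Pa + b * Pb \<le> P + c * Pc"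
proof (cases "a + b \<le> 1")
  case True
  have "a * Pa + b * Pb \<le> a * P + b * P"
    using assms by (intro add_mono mult_left_mono) linarith+
  also have "\<dots> = (a + b) * P"
    by (simp add: algebra_simps)
  also have "\<dots> \<le> P"
    using mult_right_mono[OF True, of P] assms by auto
  also have "\<dots> \<le> P + c * Pc"
    using assms by simp
  finally show ?thesis .
next
  case False
  \<comment> \<open>The right-hand side expands to
    \<open>P - a * Pa - b * Pb + (a + b - 1) * Pc\<close>, and each of its three summands is
    nonnegative.\<close>
  have "0 \<le> (P - Pa - Pb + Pc) + (1 - a) * (Pa - Pc) + (1 - b) * (Pb - Pc)"
    using assms by (intro add_nonneg_nonneg[of "P - Pa - Pb + Pc"] add_nonneg_nonneg[of "P - Pa - Pb + Pc + _"]
        mult_nonneg_nonneg) auto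
  moreover have "(a + b - 1) * Pc \<le> c * Pc"
    using assms by (intro mult_right_mono) auto
  ultimately show ?thesis
    by (simp add: algebra_simps)
qed

text \<open>
  The factors \<open>c\<close> need not be the product of \<open>a\<close> and \<open>b\<close>: when both insertions are the same edge,
  \<open>c = a = b\<close>.
\<close>

lemma killed_funpow_supermodular:
  fixes w wa wb wc :: "'a \<Rightarrow> 'a \<Rightarrow> real" and a b c :: "'a \<Rightarrow> real"
  assumes w: "\<And>i j. i \<in> A \<Longrightarrow> j \<in> A \<Longrightarrow> 0 \<le> w i j"
    and wa: "\<And>i j. i \<in> A \<Longrightarrow> j \<in> A \<Longrightarrow> wa i j = a i * w i j"
    and wb: "\<And>i j. i \<in> A \<Longrightarrow> j \<in> A \<Longrightarrow> wb i j = b i * w i j"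
    and wc: "\<And>i j. i \<in> A \<Longrightarrow> j \<in> A \<Longrightarrow> wc i j = c i * w i j"
    and factors: "\<And>i. i \<in> A \<Longrightarrow>
      0 \<le> c i \<and> c i \<le> a i \<and> c i \<le> b i \<and> a i \<le> 1 \<and> b i \<le> 1 \<and> a i + b i \<le> 1 + c i"
    and i: "i \<in> A"
  defines "p \<equiv> \<lambda>w k. (killed w A ^^ k) (\<lambda>_. 1)"
  shows "0 \<le> p wc k i \<and> p wc k i \<le> p wa k i \<and> p wc k i \<le> p wb k i
    \<and> p wa k i \<le> p w k i \<and> p wb k i \<le> p w k i \<and> p wa k i + p wb k i \<le> p w k i + p wc k i"
  using i
proof (induction k arbitrary: i)
  case 0
  then show ?case by (simp add: p_def)
next
  case (Suc k)
  \<comment> \<open>All four operators agree up to the row factor. Since \<open>S\<close> is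
    monotone and additive, every inequality of the induction hypothesis passes through it, and the
    row factors are dealt with afterwards.\<close>
  define S where "S f = (\<Sum>j\<in>A. w i j * f j)" for f
  have Suc_eq: "p w (Suc k) i = S (p w k)" "p wa (Suc k) i = a i * S (p wa k)"
    "p wb (Suc k) i = b i * S (p wb k)" "p wc (Suc k) i = c i * S (p wc k)"
    using Suc.prems
    by (simp_all add: p_def killed_def S_def sum_distrib_left wa wb wc mult.assoc cong: sum.cong)
  have mono: "S f \<le> S g" if "\<And>j. j \<in> A \<Longrightarrow> f j \<le> g j" for f g
    unfolding S_def using that Suc.prems by (intro sum_mono mult_left_mono w) auto
  have add: "S (\<lambda>j. f j + g j) = S f + S g" for f g
    by (simp add: S_def sum.distrib algebra_simps)
  have 1: "0 \<le> S (p wc k)"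
    using mono[of "\<lambda>_. 0" "p wc k"] Suc.IH by (simp add: S_def)
  have 2: "S (p wc k) \<le> S (p wa k)" "S (p wc k) \<le> S (p wb k)"
    "S (p wa k) \<le> S (p w k)" "S (p wb k) \<le> S (p w k)"
    using Suc.IH by (auto intro!: mono)
  have 3: "S (p wa k) + S (p wb k) \<le> S (p w k) + S (p wc k)"
    unfolding add[symmetric] using Suc.IH by (auto intro!: mono)
  have f: "0 \<le> c i" "c i \<le> a i" "c i \<le> b i" "a i \<le> 1" "b i \<le> 1" "a i + b i \<le> 1 + c i"
    using factors[OF Suc.prems] by auto
  have "a i * S (p wa k) \<le> 1 * S (p w k)" "b i * S (p wb k) \<le> 1 * S (p w k)"
    "c i * S (p wc k) \<le> a i * S (p wa k)" "c i * S (p wc k) \<le> b i * S (p wb k)"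
    using 1 2 f by (intro mult_mono; linarith)+
  moreover have "0 \<le> c i * S (p wc k)"
    using 1 f by simp
  ultimately show ?case
    unfolding Suc_eq using supermodular_scaling[OF 1 2 3 f] by simp
qed

section \<open>Finite-time marginals of the Ionescu-Tulcea measure\<close>

text \<open>The marginal of the projective limit on \<open>{0..<n}\<close> is
  \<open>CI {0..<n}\<close>. As \<open>up_to {0..<n} = n\<close>, this is the \<open>n\<close>-fold
  kernel composition itself, with nothing left to project away.\<close>

lemma (in Ionescu_Tulcea) nn_integral_lim_eq_C:
  assumes f: "f \<in> borel_measurable (PiM {0..<n} M)"
  shows "(\<integral>\<^sup>+\<omega>. f (restrict \<omega> {0..<n}) \<partial>PF.lim) = (\<integral>\<^sup>+\<omega>. f \<omega> \<partial>C 0 n (\<lambda>_. undefined))"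
proof -
  have "up_to {0..<n} = n"
    unfolding up_to_def by (rule Least_equality) (auto simp: not_less[symmetric])
  then have CI: "CI {0..<n} = C 0 n (\<lambda>_. undefined)"
    using distr_C[of n n "\<lambda>_. undefined" 0] by (simp add: CI_def)
  have meas: "(\<lambda>\<omega>. restrict \<omega> {0..<n}) \<in> measurable PF.lim (PiM {0..<n} M)"
    unfolding measurable_cong_sets[OF PF.sets_lim refl] by (rule measurable_restrict_subset) simp
  have "(\<integral>\<^sup>+\<omega>. f \<omega> \<partial>distr PF.lim (PiM {0..<n} M) (\<lambda>\<omega>. restrict \<omega> {0..<n})) =
    (\<integral>\<^sup>+\<omega>. f (restrict \<omega> {0..<n}) \<partial>PF.lim)"
    using f by (intro nn_integral_distr meas) simp
  then show ?thesis
    by (simp add: distr_lim CI)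
qed

text \<open>Peels off the last step: \<open>C 0 (Suc n)\<close> is \<open>C 0 n\<close> bound to
  \<open>eP n\<close>, which extends a history by a coordinate drawn from
  \<open>P n\<close>.\<close>

lemma (in Ionescu_Tulcea) nn_integral_C_Suc:
  assumes f: "f \<in> borel_measurable (PiM {0..<Suc n} M)"
  shows "(\<integral>\<^sup>+\<omega>. f \<omega> \<partial>C 0 (Suc n) (\<lambda>_. undefined))
    = (\<integral>\<^sup>+\<omega>. (\<integral>\<^sup>+x. f (fun_upd \<omega> n x) \<partial>P n \<omega>) \<partial>C 0 n (\<lambda>_. undefined))"
proof -
  \<comment> \<open>The empty product has exactly one point, the empty history from which
    \<open>C 0\<close> starts.\<close>
  have [simp]: "(\<lambda>_. undefined) \<in> space (PiM {0..<0} M)"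
    by (simp add: space_PiM)
  have eP: "eP n \<in> measurable (C 0 n (\<lambda>_. undefined)) (subprob_algebra (PiM {0..<Suc n} M))"
    using measurable_eP[of n] sets_C[of "\<lambda>_. undefined" 0 n] by (simp cong: measurable_cong_sets)
  have "(\<integral>\<^sup>+\<omega>. f \<omega> \<partial>C 0 (Suc n) (\<lambda>_. undefined))
    = (\<integral>\<^sup>+\<omega>. (\<integral>\<^sup>+y. f y \<partial>eP n \<omega>) \<partial>C 0 n (\<lambda>_. undefined))"
    using nn_integral_bind[OF f eP] by simp
  also have "\<dots> = (\<integral>\<^sup>+\<omega>. (\<integral>\<^sup>+x. f (fun_upd \<omega> n x) \<partial>P n \<omega>) \<partial>C 0 n (\<lambda>_. undefined))"
    using space_C[of "\<lambda>_. undefined" 0 n] by (intro nn_integral_cong nn_integral_eP f) simp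
  finally show ?thesis .
qed

section \<open>The bubble radius as a sum of survival probabilities\<close>

context walk_graph
begin

lemma finite_pverts: "finite (pverts G)"
  using pair_finite_verts by (simp add: pair_pre_digraph.truncate_def)

text \<open>Integrating out the last position replaces the terminal function \<open>f\<close> by
  \<open>killed (weight G) A f\<close> and shortens the path by one. The induction therefore runs
  from the end of the path and needs arbitrary nonnegative \<open>f\<close>, although only
  \<open>f = 1\<close> is wanted later.\<close>

lemma nn_integral_killed_path:
  assumes v: "v \<in> A" and A: "A \<subseteq> pverts G" and f: "\<And>i. i \<in> A \<Longrightarrow> 0 \<le> f i"
  shows "(\<integral>\<^sup>+\<omega>. (\<Prod>i\<le>k. indicator A (\<omega> i)) * ennreal (f (\<omega> k)) \<partial>random_walk G v)
    = ennreal ((killed (weight G) A ^^ k) f v)"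
proof -
  let ?M = "count_space (pverts G)"
  have v': "v \<in> pverts G"
    using v A by auto
  interpret IT: Ionescu_Tulcea "walk_kernel G v" "\<lambda>_. count_space (pverts G)"
    using v' by (rule Ionescu_Tulcea_walk_kernel)
  let ?F = "\<lambda>k f (\<omega>::nat \<Rightarrow> 'a). (\<Prod>i\<le>k. indicator A (\<omega> i)) * ennreal (f (\<omega> k))"
  let ?C = "\<lambda>n. IT.C 0 n (\<lambda>_. undefined)"
  \<comment> \<open>\<open>?F k f\<close> reads the positions at times \<open>0\<close> to
    \<open>k\<close>, that is \<open>Suc k\<close> coordinates.\<close>
  have meas: "?F k f \<in> borel_measurable (PiM {0..<Suc k} (\<lambda>_. ?M))" for k f
  proof -
    have "(\<lambda>\<omega>. g (\<omega> i)) \<in> borel_measurable (PiM {0..<Suc k} (\<lambda>_. ?M))"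
      if "i \<le> k" for i and g :: "'a \<Rightarrow> ennreal"
      using that by (intro measurable_compose[OF measurable_component_singleton]) auto
    then show ?thesis
      by (intro borel_measurable_times_ennreal borel_measurable_prod_ennreal) auto
  qed
  have [simp]: "restrict \<omega> {0..<Suc k} i = \<omega> i" if "i \<le> k" for \<omega> :: "nat \<Rightarrow> 'a" and i k
    using that by simp
  have "(\<integral>\<^sup>+\<omega>. ?F k f \<omega> \<partial>random_walk G v) = (\<integral>\<^sup>+\<omega>. ?F k f \<omega> \<partial>?C (Suc k))"
    using IT.nn_integral_lim_eq_C[OF meas[of k f]] by (simp add: random_walk_def)
  also have "\<dots> = ennreal ((killed (weight G) A ^^ k) f v)"
    using f
  proof (induction k arbitrary: f)
    case 0
    have "(\<integral>\<^sup>+\<omega>. ?F 0 f \<omega> \<partial>?C (Suc 0))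
      = (\<integral>\<^sup>+\<omega>. (\<integral>\<^sup>+x. ?F 0 f (fun_upd \<omega> 0 x) \<partial>walk_kernel G v 0 \<omega>) \<partial>?C 0)"
      by (rule IT.nn_integral_C_Suc[OF meas])
    also have "\<dots> = (\<integral>\<^sup>+\<omega>. ennreal (f v) \<partial>?C 0)"
      using v v' by (simp add: walk_kernel_def nn_integral_return)
    also have "\<dots> = ennreal (f v)"
      using prob_space.emeasure_space_1[OF IT.prob_space_C[of "\<lambda>_. undefined" 0 0]]
      by (simp only: nn_integral_const) (simp add: space_PiM)
    finally show ?case by simp
  next
    case (Suc k)
    have "(\<integral>\<^sup>+\<omega>. ?F (Suc k) f \<omega> \<partial>?C (Suc (Suc k)))
      = (\<integral>\<^sup>+\<omega>. (\<integral>\<^sup>+x. ?F (Suc k) f (fun_upd \<omega> (Suc k) x) \<partial>walk_kernel G v (Suc k) \<omega>) \<partial>?C (Suc k))"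
      by (rule IT.nn_integral_C_Suc[OF meas])
    also have "\<dots> = (\<integral>\<^sup>+\<omega>. ?F k (killed (weight G) A f) \<omega> \<partial>?C (Suc k))"
    proof (rule nn_integral_cong)
      fix \<omega> assume "\<omega> \<in> space (?C (Suc k))"
      have prod: "(\<Prod>i\<le>k. indicator A (fun_upd \<omega> (Suc k) x i)) = (\<Prod>i\<le>k. indicator A (\<omega> i) :: ennreal)" for x
        by (intro prod.cong) auto
      have "(\<integral>\<^sup>+x. ?F (Suc k) f (fun_upd \<omega> (Suc k) x) \<partial>walk_kernel G v (Suc k) \<omega>)
        = (\<Sum>j\<in>pverts G. (\<Prod>i\<le>k. indicator A (\<omega> i)) *
            (ennreal (weight G (\<omega> k) j) * ennreal (f j) * indicator A j))"
        by (simp add: walk_kernel_def nn_integral_point_measure_finite finite_pverts prod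
            mult_ac del: fun_upd_apply) (simp add: mult_ac)
      also have "\<dots> = (\<Prod>i\<le>k. indicator A (\<omega> i)) *
          (\<Sum>j\<in>pverts G. ennreal (weight G (\<omega> k) j) * ennreal (f j) * indicator A j)"
        by (rule sum_distrib_left[symmetric])
      also have "(\<Sum>j\<in>pverts G. ennreal (weight G (\<omega> k) j) * ennreal (f j) * indicator A j)
        = (\<Sum>j\<in>A. ennreal (weight G (\<omega> k) j) * ennreal (f j))"
        using A finite_pverts by (intro sum.mono_neutral_cong_right) auto
      also have "(\<Prod>i\<le>k. indicator A (\<omega> i)) * \<dots> = ?F k (killed (weight G) A f) \<omega>"
      \<comment> \<open>On \<open>A\<close> all terms are nonnegative, so the sum can be moved
        inside \<open>ennreal\<close>; off \<open>A\<close> the indicator at time \<open>k\<close>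
        annihilates both sides.\<close>
      proof (cases "\<omega> k \<in> A")
        case True
        have "(\<Sum>j\<in>A. ennreal (weight G (\<omega> k) j) * ennreal (f j))
          = (\<Sum>j\<in>A. ennreal (weight G (\<omega> k) j * f j))"
          using A True Suc.prems by (intro sum.cong refl ennreal_mult[symmetric] weight_nonneg) auto
        also have "\<dots> = ennreal (killed (weight G) A f (\<omega> k))"
          unfolding killed_def
          using A True Suc.prems by (intro sum_ennreal mult_nonneg_nonneg weight_nonneg) auto
        finally show ?thesis by simp
      next
        case False
        then have "(\<Prod>i\<le>k. indicator A (\<omega> i) :: ennreal) = 0"
          by (intro prod_zero bexI[of _ k]) auto
        then show ?thesis by (simp only: mult_zero_left)
      qed
      finally show "(\<integral>\<^sup>+x. ?F (Suc k) f (fun_upd \<omega> (Suc k) x) \<partial>walk_kernel G v (Suc k) \<omega>)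
        = ?F k (killed (weight G) A f) \<omega>" .
    qed
    also have "\<dots> = ennreal ((killed (weight G) A ^^ k) (killed (weight G) A f) v)"
    proof (rule Suc.IH)
      show "0 \<le> killed (weight G) A f i" if "i \<in> A" for i
        using that A Suc.prems unfolding killed_def
        by (intro sum_nonneg mult_nonneg_nonneg weight_nonneg) auto
    qed
    finally show ?case
      by (simp add: funpow_swap1)
  qed
  finally show ?thesis .
qed

text \<open>Tail-sum formula: a path avoids \<open>S\<close> through time \<open>k\<close> exactly
  when \<open>k\<close> is smaller than the hitting time, so the sum counts the \<open>k < s\<close>
  below it.\<close>

lemma min_hitting_time:
  "real (the_enat (min (enat s) (hitting_time S \<omega>)))
    = (\<Sum>k<s. if \<forall>i\<le>k. \<omega> i \<notin> S then 1 else 0)"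
proof (cases "\<exists>n. \<omega> n \<in> S")
  case True
  define T where "T = (LEAST n. \<omega> n \<in> S)"
  have T: "\<omega> T \<in> S" "\<And>n. \<omega> n \<in> S \<Longrightarrow> T \<le> n"
    using True unfolding T_def by (auto intro: LeastI_ex Least_le)
  have "hitting_time S \<omega> = enat T"
    unfolding hitting_time_def using T by (intro antisym Inf_lower Inf_greatest) auto
  moreover have "(\<forall>i\<le>k. \<omega> i \<notin> S) \<longleftrightarrow> k < T" for k
    using T by (meson le_less_trans not_le)
  moreover have "{..<s} \<inter> {k. k < T} = {..<min s T}"
    by auto
  ultimately show ?thesis
    by (simp add: sum.If_cases)
next
  case False
  \<comment> \<open>The infimum of the empty set is infinite, so the truncation gives
    \<open>s\<close>.\<close>
  then have "hitting_time S \<omega> = \<infinity>"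
    by (simp add: hitting_time_def top_enat_def)
  then show ?thesis
    using False by simp
qed

lemma bubble_radius_eq:
  assumes v: "v \<in> pverts G"
  defines "A \<equiv> {x \<in> pverts G. color G x = color G v}"
  shows "bubble_radius G s v = (\<Sum>k<s. (killed (weight G) A ^^ k) (\<lambda>_. 1) v)"
proof -
  let ?R = "random_walk G v" and ?X = "\<lambda>k::nat. \<lambda>\<omega>. \<Prod>i\<le>k. indicator A (\<omega> i) :: real"
  have A: "A \<subseteq> pverts G" and vA: "v \<in> A"
    using v by (auto simp: A_def)
  interpret IT: Ionescu_Tulcea "walk_kernel G v" "\<lambda>_. count_space (pverts G)"
    using v by (rule Ionescu_Tulcea_walk_kernel)
  \<comment> \<open>Trajectories never leave \<open>pverts G\<close>, hence avoiding
    \<open>other_color G v\<close> is the same as staying in \<open>A\<close>.\<close>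
  have space: "\<omega> i \<in> pverts G" if "\<omega> \<in> space ?R" for \<omega> i
    using that by (auto simp: random_walk_def space_PiM)
  have meas: "?X k \<in> borel_measurable ?R" for k
  proof -
    have "(\<lambda>\<omega>. indicator A (\<omega> i)) \<in> borel_measurable (PiM UNIV (\<lambda>_. count_space (pverts G)))"
      for i :: nat
      by (intro measurable_compose[OF measurable_component_singleton]) auto
    then show ?thesis
      unfolding random_walk_def measurable_cong_sets[OF IT.PF.sets_lim refl]
      by (intro borel_measurable_prod) auto
  qed
  have "ennreal (?X k \<omega>) = (\<Prod>i\<le>k. indicator A (\<omega> i))" for k \<omega>
    by (subst prod_ennreal[symmetric]) (auto simp: ennreal_indicator)
  then have nn: "(\<integral>\<^sup>+\<omega>. ennreal (?X k \<omega>) \<partial>?R) = ennreal ((killed (weight G) A ^^ k) (\<lambda>_. 1) v)" for k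
    using nn_integral_killed_path[OF vA A, of "\<lambda>_. 1" k] by simp
  have nonneg: "0 \<le> (killed (weight G) A ^^ k) (\<lambda>_. 1) v" for k
    using A vA by (intro killed_funpow_nonneg) (auto intro: weight_nonneg)
  have has: "has_bochner_integral ?R (?X k) ((killed (weight G) A ^^ k) (\<lambda>_. 1) v)" for k
    by (rule has_bochner_integral_nn_integral[OF meas _ nonneg nn]) (auto intro!: AE_I2 prod_nonneg)
  have "bubble_radius G s v = (\<integral>\<omega>. (\<Sum>k<s. ?X k \<omega>) \<partial>?R)"
    unfolding bubble_radius_def min_hitting_time
  proof (intro Bochner_Integration.integral_cong refl sum.cong)
    fix \<omega> k assume \<omega>: "\<omega> \<in> space ?R"
    have "\<omega> i \<notin> other_color G v \<longleftrightarrow> \<omega> i \<in> A" for i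
      using space[OF \<omega>, of i] by (auto simp: other_color_def A_def)
    then show "(if \<forall>i\<le>k. \<omega> i \<notin> other_color G v then 1 else 0) = ?X k \<omega>"
      by (auto simp: indicator_def)
  qed
  also have "\<dots> = (\<Sum>k<s. (killed (weight G) A ^^ k) (\<lambda>_. 1) v)"
    using has by (intro has_bochner_integral_integral_eq has_bochner_integral_sum)
  finally show ?thesis .
qed

end

section \<open>Effect of edge insertion on the graph and its weights\<close>

lemma insert_edge_simps [simp]:
  "pverts (insert_edge m e G) = pverts G"
  "color (insert_edge m e G) = color G"
  "parcs (insert_edge m e G) = insert e (parcs G)"
  "weight (insert_edge m e G) i j =
    (if (i, j) = e then m e else if i = fst e then (1 - m e) * weight G i j else weight G i j)"
  by (simp_all add: insert_edge_def)

lemma insert_edges_simps [simp]: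
  "insert_edges m [] G = G"
  "insert_edges m (e # es) G = insert_edges m es (insert_edge m e G)"
  by (simp_all add: insert_edges_def)

lemma pverts_insert_edges [simp]: "pverts (insert_edges m es G) = pverts G"
  and color_insert_edges [simp]: "color (insert_edges m es G) = color G"
  by (induction es arbitrary: G) simp_all

lemma walk_graph_insert_edge:
  assumes "walk_graph G" and e: "fst e \<in> pverts G" "snd e \<in> pverts G" "fst e \<noteq> snd e"
    and new: "e \<notin> parcs G" and m: "0 \<le> m e" "m e \<le> 1"
  shows "walk_graph (insert_edge m e G)"
proof -
  interpret walk_graph G by fact
  have arcs: "fst a \<in> pverts G" "snd a \<in> pverts G" "fst a \<noteq> snd a" if "a \<in> parcs G" for a
    using that arc_fst_in_verts[of a] arc_snd_in_verts[of a] no_loops'[of "fst a" "snd a"]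
    by (auto simp: pair_pre_digraph.truncate_def)
  have "finite (parcs G)"
    using pair_finite_arcs by (simp add: pair_pre_digraph.truncate_def)
  show ?thesis
  proof
    show "(\<Sum>j\<in>pverts (insert_edge m e G). weight (insert_edge m e G) i j) = 1"
      if "i \<in> pverts (insert_edge m e G)" for i
    proof (cases "i = fst e")
      case True
      \<comment> \<open>A new edge had weight zero, so the remaining entries of its row sum to one;
        after scaling they leave exactly \<open>m e\<close> for the new edge.\<close>
      have "weight G (fst e) (snd e) = 0"
        using e new by (intro weight_non_edge) auto
      then have "(1 - m e) * (\<Sum>j\<in>pverts G - {snd e}. weight G (fst e) j) = 1 - m e"
        using weight_row_sum[OF e(1)] sum.remove[OF finite_pverts e(2), of "weight G (fst e)"] by simp
      moreover have "(\<Sum>j\<in>pverts G. weight (insert_edge m e G) i j)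
        = m e + (\<Sum>j\<in>pverts G - {snd e}. (1 - m e) * weight G (fst e) j)"
        using True by (subst sum.remove[OF finite_pverts e(2)]) (auto simp: prod_eq_iff intro!: sum.cong)
      ultimately show ?thesis
        by (simp add: sum_distrib_left)
    next
      case False
      then have "(i, j) \<noteq> e" for j
        by auto
      then show ?thesis
        using False that weight_row_sum by simp
    qed
  qed (use e m arcs finite_pverts \<open>finite (parcs G)\<close> in
      \<open>auto simp: pair_pre_digraph.truncate_def weight_nonneg weight_non_edge\<close>)
qed

text \<open>Distinctness keeps every edge of the list new at the moment of its insertion.\<close>

lemma walk_graph_insert_edges:
  assumes "walk_graph G" and "distinct es"
    and "\<And>e. e \<in> set es \<Longrightarrow> fst e \<in> pverts G \<and> snd e \<in> pverts G \<and> fst e \<noteq> snd e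
      \<and> e \<notin> parcs G \<and> 0 \<le> m e \<and> m e \<le> 1"
  shows "walk_graph (insert_edges m es G)"
  using assms
proof (induction es arbitrary: G)
  case (Cons e es)
  have "walk_graph (insert_edge m e G)"
    using Cons.prems by (intro walk_graph_insert_edge) auto
  then show ?case
    using Cons.prems(2,3) by (fastforce intro!: Cons.IH)
qed simp

text \<open>A column that no new edge points to is only rescaled, and the factor is the same for
  every order of insertion. This covers all columns of one color class when the new edges end in the
  other.\<close>

lemma weight_insert_edges:
  assumes "j \<notin> snd ` set es"
  shows "weight (insert_edges m es G) i j =
    (\<Prod>e\<leftarrow>es. if i = fst e then 1 - m e else 1) * weight G i j"
  using assms
proof (induction es arbitrary: G)
  case (Cons e es)
  then have "(i, j) \<noteq> e"
    by force
  with Cons show ?case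
    by simp
qed simp

section \<open>The two gain inequalities\<close>

theorem lemma5p6:
  fixes G :: "'a walk_graph" and t :: nat and C :: color
    and v u w\<^sub>v w\<^sub>u :: 'a and m :: "'a \<times> 'a \<Rightarrow> real" and es :: "('a \<times> 'a) list"
  assumes "walk_graph G"
    and "0 < t" and "2 < real t / 2"
    and "v \<in> parochial G C t" and "u \<in> parochial G C t"
    and "w\<^sub>v \<in> other_color G v" and "w\<^sub>u \<in> other_color G v"
    and "(v, w\<^sub>v) \<notin> parcs G" and "(u, w\<^sub>u) \<notin> parcs G"
    and "0 \<le> m (v, w\<^sub>v)" and "m (v, w\<^sub>v) \<le> 1"
    and "0 \<le> m (u, w\<^sub>u)" and "m (u, w\<^sub>u) \<le> 1"
    and "distinct es" and "set es = {(v, w\<^sub>v), (u, w\<^sub>u)}"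
  shows "gain G (parochial G C t) [(v, w\<^sub>v)] m t \<le> gain G (parochial G C t) es m t
    \<and> gain G (parochial G C t) es m t
      \<le> gain G (parochial G C t) [(v, w\<^sub>v)] m t + gain G (parochial G C t) [(u, w\<^sub>u)] m t"
proof -
  interpret walk_graph G by fact
  let ?ev = "(v, w\<^sub>v)" and ?eu = "(u, w\<^sub>u)"
  define A where "A = {x \<in> pverts G. color G x = C}"
  define r where "r es i = (\<Prod>e\<leftarrow>es. if i = fst e then 1 - m e else 1)" for es and i :: 'a
  define p where "p es k = (killed (weight (insert_edges m es G)) A ^^ k) (\<lambda>_. 1)" for es k
  have vu: "v \<in> pverts G" "color G v = C" "u \<in> pverts G" "color G u = C"
    using assms by (auto simp: parochial_def)
  have ws: "w\<^sub>v \<in> pverts G - A" "w\<^sub>u \<in> pverts G - A"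
    using assms vu by (auto simp: other_color_def A_def)
  \<comment> \<open>Insertion keeps vertices and colors, so the same \<open>A\<close> serves all the
    graphs.\<close>
  have bubble: "bubble_radius (insert_edges m l G) t x = (\<Sum>k<t. p l k x)"
    if "distinct l" "set l \<subseteq> {?ev, ?eu}" "x \<in> A" for l x
  proof -
    have "walk_graph (insert_edges m l G)"
      using that vu ws assms by (intro walk_graph_insert_edges) (auto simp: A_def)
    from walk_graph.bubble_radius_eq[OF this, of x t] show ?thesis
      using that by (simp add: A_def p_def)
  qed
  have weight: "weight (insert_edges m l G) i j = r l i * weight G i j"
    if "set l \<subseteq> {?ev, ?eu}" "j \<in> A" for l i j
    using that ws by (auto simp: r_def intro!: weight_insert_edges)
  \<comment> \<open>If the two edges coincide there is a single insertion; otherwise either order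
    may occur.\<close>
  have es: "es = [?ev] \<and> ?ev = ?eu \<or> es = [?ev, ?eu] \<or> es = [?eu, ?ev]"
  proof (cases "?ev = ?eu")
    case True
    then have "length es = 1"
      using distinct_card[OF assms(14)] assms(15) by simp
    then obtain e where "es = [e]"
      by (auto simp: length_Suc_conv)
    then show ?thesis
      using True assms(15) by auto
  next
    case False
    then have "length es = 2"
      using distinct_card[OF assms(14)] assms(15) by (simp del: prod.inject)
    then obtain e f where "es = [e, f]"
      by (auto simp: length_Suc_conv numeral_2_eq_2)
    then show ?thesis
      using False assms(15) by (auto simp: doubleton_eq_iff)
  qed
  have factors: "0 \<le> r es i \<and> r es i \<le> r [?ev] i \<and> r es i \<le> r [?eu] i
      \<and> r [?ev] i \<le> 1 \<and> r [?eu] i \<le> 1 \<and> r [?ev] i + r [?eu] i \<le> 1 + r es i" for i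
  proof -
    define a b where "a = r [?ev] i" and "b = r [?eu] i"
    have ab: "0 \<le> a" "a \<le> 1" "0 \<le> b" "b \<le> 1"
      using assms by (auto simp: a_def b_def r_def)
    \<comment> \<open>The first alternative covers coinciding edges. In the second,
      \<open>0 \<le> (1 - a) * (1 - b)\<close> is the supermodular bound
      \<open>a + b \<le> 1 + a * b\<close>.\<close>
    have "r es i = a \<and> a = b \<or> r es i = a * b"
      using es by (elim disjE) (simp_all add: a_def b_def r_def)
    moreover have "0 \<le> (1 - a) * (1 - b)" "0 \<le> a * b" "a * b \<le> a" "a * b \<le> b"
      using ab by (simp_all add: mult_left_le mult_left_le_one_le)
    ultimately show ?thesis
      using ab unfolding a_def[symmetric] b_def[symmetric] by (auto simp: algebra_simps)
  qed
  have super: "p es k i \<le> p [?ev] k i" "p [?ev] k i + p [?eu] k i \<le> p [] k i + p es k i"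
    if "i \<in> A" for k i
    using killed_funpow_supermodular[of A "weight G" "weight (insert_edges m [?ev] G)" "r [?ev]"
        "weight (insert_edges m [?eu] G)" "r [?eu]" "weight (insert_edges m es G)" "r es" i k]
      that weight factors assms(15)
    by (auto simp: p_def A_def weight_nonneg simp del: insert_edges_simps(2))
  have sub: "x \<in> A" if "x \<in> parochial G C t" for x
    using that by (auto simp: parochial_def A_def)
  have le: "bubble_radius (insert_edges m es G) t x \<le> bubble_radius (insert_edges m [?ev] G) t x"
    "bubble_radius (insert_edges m [?ev] G) t x + bubble_radius (insert_edges m [?eu] G) t x
      \<le> bubble_radius G t x + bubble_radius (insert_edges m es G) t x"
    if x: "x \<in> parochial G C t" for x
    using bubble[of "[?ev]" x] bubble[of "[?eu]" x] bubble[of es x] bubble[of "[]" x]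
      super[OF sub[OF x]] sub[OF x] assms(14,15)
    by (auto simp: sum.distrib[symmetric] intro!: sum_mono simp del: insert_edges_simps(2))
  show ?thesis
    \<comment> \<open>All gains average over the same vertex set, so it suffices to compare the
      summands; there the two parts of \<open>le\<close> are monotonicity and subadditivity of the
      decrease in bubble radius.\<close>
    unfolding gain_def distrib_left[symmetric] sum.distrib[symmetric]
    using le by (intro conjI mult_left_mono sum_mono) (auto simp: algebra_simps simp del: insert_edges_simps(2))
qed

end
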